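(* Let $q=p^m$ with $p$ prime and $m\in\mathbb{N}$. Let $n=rp^e$, where $e\in\mathbb{N}$ ($e\geq 1$) and $r$ is either $1$ or a prime different from $p$ such that $q$ is a primitive element modulo $r$. Let $0\le k\le n-1$ and let $P(x)$ be an $N_k$-polynomial of degree $n$ over $\mathbb{F}_q$. Let $\delta\in\mathbb{F}_p^{*}$ and define recursively $$F_0(x)=P^{*}(x),\qquad F_u(x)=(x^p-x+\delta)^{np^{u-1}}\,F_{u-1}\!\left(\frac{x^p-x}{x^p-x+\delta}\right)\quad (u\ge 1).$$ If $k<p^e$ and $$\mathrm{Tr}_{q|p}\!\left(\frac{{P^{*}}'(0)}{P^{*}(0)}\right)\cdot \mathrm{Tr}_{q|p}\!\left(\frac{{P^{*}}'(1)}{P^{*}(1)}\right)\neq 0,$$ then $(F_u^{*}(x))_{u\ge 0}$ is a sequence of $N_k$-polynomials over $\mathbb{F}_q$, with $F_u^{*}$ of degree $np^u$.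
   Context: For $0\le k\le n-1$, an element $\alpha\in\mathbb{F}_{q^n}$ is called $k$-normal over $\mathbb{F}_q$ if $\deg\gcd\big(x^n-1,\ \sum_{i=0}^{n-1}\alpha^{q^i}x^{n-1-i}\big)=k$; for degree $N$ polynomials the analogous definition uses $\mathbb{F}_{q^N}$ and $x^N-1$. A monic irreducible polynomial of degree $N$ over $\mathbb{F}_q$ is a $k$-normal polynomial ($N_k$-polynomial) if its roots are $k$-normal elements of $\mathbb{F}_{q^N}$ over $\mathbb{F}_q$. For a polynomial $G$ of degree $d$, its reciprocal polynomial is $G^{*}(x)=x^dG(1/x)$. ${P^{*}}'(0)$ and ${P^{*}}'(1)$ denote the formal derivative of $P^{*}$ evaluated at $0$ and $1$. $\mathrm{Tr}_{q|p}(\beta)=\sum_{i=0}^{m-1}\beta^{p^i}$ is the trace from $\mathbb{F}_q$ to $\mathbb{F}_p$.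
   Formalization: F_u^* has leading coefficient δ^{ru}, so it need not be monic as an N_k-polynomial must be (e.g. q=p=n=3, P=x^3+x^2+2, δ=2, u=1); the formal statement asserts the N_k-property of F_u^* divided by its leading coefficient. *)

theory Defs
  imports
    "HOL-Algebra.Algebraic_Closure_Type"
    "HOL-Computational_Algebra.Computational_Algebra"
    "HOL-Library.Cardinality"
    "HOL-Number_Theory.Residue_Primitive_Roots"
begin

(* The ground field F_q is a type 'a of class finite_field, so q = CARD('a).  All extensions
   F_(q^N), N >= 1, live inside the type 'a alg_closure: F_(q^N) is its unique subfield with
   q^N elements, namely the set of fixed points of x \<mapsto> x^(q^N). *)

definition ext_field :: "nat \<Rightarrow> 'a::finite_field alg_closure set" where
  "ext_field N = {x. x ^ (CARD('a) ^ N) = x}"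

(* The gcd is taken in the polynomial ring over the algebraic closure; its degree is the same
   as that of the gcd over F_(q^N). *)
definition k_normal :: "nat \<Rightarrow> nat \<Rightarrow> 'a::finite_field alg_closure \<Rightarrow> bool" where
  "k_normal k N \<alpha> \<longleftrightarrow> k < N \<and> \<alpha> \<in> ext_field N \<and>
     degree (gcd (monom 1 N - 1) (\<Sum>i<N. monom (\<alpha> ^ (CARD('a) ^ i)) (N - 1 - i))) = k"

definition k_normal_poly :: "nat \<Rightarrow> nat \<Rightarrow> 'a::finite_field poly \<Rightarrow> bool" where
  "k_normal_poly k N P \<longleftrightarrow> lead_coeff P = 1 \<and> irreducible P \<and> degree P = N \<and>
     (\<forall>\<alpha>. poly (map_poly to_ac P) \<alpha> = 0 \<longrightarrow> k_normal k N \<alpha>)"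

(* The polynomials F_u^* built below need not be monic: F_(u+1)(0) = \<delta>^(n p^u) F_u(0), so for
   monic P of degree n = r p^e the leading coefficient of F_u^* is \<delta>^(r u).  Being a k-normal
   polynomial (which includes being monic) is therefore asserted of the monic associate. *)
definition monic_assoc :: "'a::field poly \<Rightarrow> 'a poly" where
  "monic_assoc G = smult (inverse (lead_coeff G)) G"

(* Tr from F_(p^m) to F_p, with values in the prime field of 'a. *)
definition abs_trace :: "nat \<Rightarrow> nat \<Rightarrow> 'a::finite_field \<Rightarrow> 'a" where
  "abs_trace p m \<beta> = (\<Sum>i<m. \<beta> ^ (p ^ i))"

(* The polynomial B^N * F(A/B), with denominators cleared; meaningful for degree F \<le> N,
   see to_fract_frac_subst. *)
definition frac_subst :: "nat \<Rightarrow> 'a::field poly \<Rightarrow> 'a poly \<Rightarrow> 'a poly \<Rightarrow> 'a poly" where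
  "frac_subst N A B F = (\<Sum>i\<le>degree F. smult (coeff F i) (A ^ i * B ^ (N - i)))"

(* F_0 = G and F_(u+1) = (x^p - x + \<delta>)^(n p^u) F_u((x^p - x) / (x^p - x + \<delta>)) *)
primrec iter_poly :: "nat \<Rightarrow> nat \<Rightarrow> 'a::field \<Rightarrow> 'a poly \<Rightarrow> nat \<Rightarrow> 'a poly" where
  "iter_poly p n \<delta> G 0 = G"
| "iter_poly p n \<delta> G (Suc u) =
     frac_subst (n * p ^ u) (monom 1 p - monom 1 1) (monom 1 p - monom 1 1 + [:\<delta>:])
       (iter_poly p n \<delta> G u)"

lemma to_fract_frac_subst:
  fixes F A B :: "'a::field poly"
  assumes "degree F \<le> N" and "B \<noteq> 0"
  shows "to_fract (frac_subst N A B F) =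
    to_fract B ^ N * poly (map_poly (\<lambda>c. to_fract [:c:]) F) (to_fract A / to_fract B)"
proof -
  have sum: "to_fract (sum f S) = (\<Sum>i\<in>S. to_fract (f i))"
    for f :: "nat \<Rightarrow> 'a poly" and S
    by (induction S rule: infinite_finite_induct) auto
  have pow: "to_fract (x ^ i) = to_fract x ^ i" for x :: "'a poly" and i
    by (induction i) auto
  have B: "to_fract B \<noteq> 0" using assms by simp
  have deg: "degree (map_poly (\<lambda>c. to_fract [:c:]) F) = degree F"
    by (rule degree_map_poly) auto
  have "to_fract (frac_subst N A B F) =
      (\<Sum>i\<le>degree F. to_fract [:coeff F i:] * (to_fract A ^ i * to_fract B ^ (N - i)))"
    unfolding frac_subst_def sum
    by (intro sum.cong refl) (simp flip: pow to_fract_mult)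
  also have "\<dots> = (\<Sum>i\<le>degree F. to_fract B ^ N *
      (to_fract [:coeff F i:] * (to_fract A / to_fract B) ^ i))"
    using assms(1) B by (intro sum.cong refl) (simp add: power_diff power_divide)
  also have "\<dots> = to_fract B ^ N * poly (map_poly (\<lambda>c. to_fract [:c:]) F) (to_fract A / to_fract B)"
    by (simp add: poly_altdef deg coeff_map_poly sum_distrib_left)
  finally show ?thesis .
qed

lemma degree_frac_subst_le:
  assumes "degree F \<le> N" "degree A \<le> d" "degree B \<le> d"
  shows "degree (frac_subst N A B F) \<le> N * d"
  unfolding frac_subst_def
proof (rule degree_sum_le)
  fix i assume "i \<in> {..degree F}"
  hence i: "i \<le> N" using assms by auto
  have "degree (A ^ i * B ^ (N - i)) \<le> degree A * i + degree B * (N - i)"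
    by (meson add_mono degree_mult_le degree_power_le order_trans)
  also have "\<dots> \<le> d * i + d * (N - i)"
    using assms by (intro add_mono mult_right_mono) auto
  also have "\<dots> = N * d" using i by (simp flip: distrib_left)
  finally show "degree (smult (coeff F i) (A ^ i * B ^ (N - i))) \<le> N * d"
    using degree_smult_le order_trans by blast
qed auto

lemma degree_iter_poly_le:
  assumes "degree G \<le> n" "p \<ge> 1"
  shows "degree (iter_poly p n \<delta> G u) \<le> n * p ^ u"
proof (induction u)
  case (Suc u)
  have A: "degree (monom 1 p - monom 1 1 :: 'a poly) \<le> p"
    by (rule degree_diff_le) (use assms in \<open>auto intro: order_trans[OF degree_monom_le]\<close>)
  have "degree (monom 1 p - monom 1 1 + [:\<delta>:]) \<le> p"
    by (rule degree_add_le[OF A]) auto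
  from degree_frac_subst_le[OF Suc A this] show ?case by (simp add: mult_ac)
qed (use assms in auto)

(* The recursion as an identity of rational functions. *)
lemma to_fract_iter_poly_Suc:
  fixes G :: "'a::field poly" and \<delta> :: 'a
  assumes "degree G \<le> n" "p \<ge> 2"
  defines "A \<equiv> monom 1 p - monom 1 1" and "B \<equiv> monom 1 p - monom 1 1 + [:\<delta>:]"
  shows "to_fract (iter_poly p n \<delta> G (Suc u)) = to_fract B ^ (n * p ^ u) *
    poly (map_poly (\<lambda>c. to_fract [:c:]) (iter_poly p n \<delta> G u)) (to_fract A / to_fract B)"
proof -
  have "coeff B p = 1" using assms by (simp add: B_def coeff_pCons split: nat.split)
  hence "B \<noteq> 0" by auto
  moreover have "p \<ge> 1" using assms by simp
  ultimately show ?thesis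
    using to_fract_frac_subst[OF degree_iter_poly_le[OF assms(1)], of p B]
    unfolding iter_poly.simps A_def B_def by blast
qed

end

(* Let g be a root of the reciprocal polynomial of F_u, N = n p^u, and let b^p - b = delta / (g - 1).
   The roots of the reciprocal polynomial of F_(u+1) are the elements 1/b.  By Artin-Schreier theory
   b has degree N p over F_q as soon as Tr(1 / (g - 1)) is nonzero.  The conjugates of b over F_(q^N)
   are the b + i with i in F_p, so the trace of 1/b from F_(q^(N p)) to F_(q^N) is -(g - 1) / delta and
   that of 1 / (1/b - 1) is (g - 1) / delta.  As p divides N, both absolute traces are nonzero multiples
   of Tr(g).  Hence it is enough that Tr(g) and Tr(1 / (g - 1)) are nonzero for the roots g of P, and by
   logarithmic differentiation these are, up to sign, the two given traces.

   For normality let G_N(g) be the sum of the g^(q^i) x^(N-1-i), i < N.  The trace relation gives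
   G_(N p)(1/b) = c (G_N(g) - (x^N - 1) / (x - 1)) modulo x^N - 1, where c = -1 / delta.  Every zero of
   x^N - 1 has multiplicity at least p^e, which exceeds k, so at each zero other than 1 the multiplicity
   in the gcd is that of G_N(g) and is unchanged in the step; at 1 it is 0, the trace being nonzero. *)

theory Submission
  imports Defs
begin

subsection \<open>Sums of Frobenius conjugates\<close>

text \<open>For q a power of the characteristic and x^(q^N) = x this is the trace of x to the fixed
  field of the q-th power map. The base stays a parameter so that absolute traces (base p), traces
  to F_q and relative traces to F_(q^N) (base q^N) are one notion.\<close>

definition frob_sum :: "nat \<Rightarrow> nat \<Rightarrow> 'a::comm_semiring_1 \<Rightarrow> 'a" where
  "frob_sum q N x = (\<Sum>i<N. x ^ (q ^ i))"

lemma power_char_uminus: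
  fixes x :: "'a::comm_ring_1"
  assumes "prime CHAR('a)" "q = CHAR('a) ^ s"
  shows "(- x) ^ q = - (x ^ q)"
proof -
  have "q > 0" using assms by (simp add: prime_gt_0_nat)
  have "(x + - x) ^ q = x ^ q + (- x) ^ q"
    using assms by (rule freshmans_dream')
  with \<open>q > 0\<close> show ?thesis by (simp add: power_0_left eq_neg_iff_add_eq_0 add.commute)
qed

lemma power_char_diff:
  fixes x y :: "'a::comm_ring_1"
  assumes "prime CHAR('a)" "q = CHAR('a) ^ s"
  shows "(x - y) ^ q = x ^ q - y ^ q"
  using freshmans_dream'[OF assms, of x "- y"] power_char_uminus[OF assms, of y] by simp

lemma power_char_eq_iff:
  fixes x y :: "'a::idom"
  assumes "prime CHAR('a)" "q = CHAR('a) ^ s"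
  shows "x ^ q = y ^ q \<longleftrightarrow> x = y"
proof
  assume "x ^ q = y ^ q"
  with power_char_diff[OF assms, of x y] have "(x - y) ^ q = 0" by simp
  thus "x = y" by (simp add: power_eq_0_iff)
qed simp

lemma power_char_of_nat:
  assumes "prime CHAR('a)"
  shows "of_nat n ^ CHAR('a) = (of_nat n :: 'a::comm_semiring_1)"
  using assms by (induction n) (auto simp: freshmans_dream power_0_left prime_gt_0_nat)

lemma frob_sum_add:
  fixes x y :: "'a::comm_semiring_1"
  assumes "prime CHAR('a)" "q = CHAR('a) ^ s"
  shows "frob_sum q N (x + y) = frob_sum q N x + frob_sum q N y"
proof -
  have "q ^ i = CHAR('a) ^ (s * i)" for i using assms by (simp add: power_mult)
  thus ?thesis
    using freshmans_dream'[OF assms(1)] by (simp add: frob_sum_def sum.distrib)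
qed

lemma power_power_fixed: "c ^ q = c \<Longrightarrow> c ^ (q ^ i) = (c::'a::monoid_mult)"
  by (induction i) (simp_all add: power_mult)

lemma frob_sum_scale:
  fixes x :: "'a::comm_semiring_1"
  assumes "c ^ q = c"
  shows "frob_sum q N (c * x) = c * frob_sum q N x"
  using power_power_fixed[OF assms]
  by (simp add: frob_sum_def power_mult_distrib sum_distrib_left)

lemma sum_lessThan_mult:
  fixes f :: "nat \<Rightarrow> 'a::comm_monoid_add"
  shows "(\<Sum>l<a * b. f l) = (\<Sum>j<b. \<Sum>i<a. f (j * a + i))"
proof -
  have "(\<Sum>l<a * b. f l) = (\<Sum>j<b. \<Sum>l = j * a..<j * a + a. f l)"
    by (simp add: sum.nat_group mult.commute)
  also have "\<dots> = (\<Sum>j<b. \<Sum>i<a. f (j * a + i))"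
  proof (rule sum.cong[OF refl])
    fix j
    show "(\<Sum>l = j * a..<j * a + a. f l) = (\<Sum>i<a. f (j * a + i))"
      by (rule sum.reindex_bij_witness[of _ "\<lambda>i. j * a + i" "\<lambda>l. l - j * a"]) auto
  qed
  finally show ?thesis .
qed

text \<open>Transitivity of the trace: an index l < a b is j a + i, the sum over j is the inner
  trace with base q^a, and the outer powers pass through it by additivity.\<close>

lemma frob_sum_mult:
  fixes x :: "'a::comm_semiring_1"
  assumes "prime CHAR('a)" "q = CHAR('a) ^ s"
  shows "frob_sum q (a * b) x = frob_sum q a (frob_sum (q ^ a) b x)"
proof -
  have q: "q ^ i = CHAR('a) ^ (s * i)" for i using assms by (simp add: power_mult)
  have "frob_sum q (a * b) x = (\<Sum>j<b. \<Sum>i<a. x ^ (q ^ (j * a + i)))"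
    by (simp add: frob_sum_def sum_lessThan_mult)
  also have "\<dots> = (\<Sum>i<a. \<Sum>j<b. (x ^ ((q ^ a) ^ j)) ^ (q ^ i))"
    by (subst sum.swap) (simp add: power_add mult.commute flip: power_mult)
  also have "\<dots> = frob_sum q a (frob_sum (q ^ a) b x)"
    unfolding frob_sum_def by (simp add: freshmans_dream_sum'[OF assms(1) q])
  finally show ?thesis .
qed

text \<open>The q-th power shifts the sum by one index, so only the end terms differ. For x^(q^N) =
  x this puts the trace into the fixed field.\<close>

lemma frob_sum_power:
  fixes x :: "'a::comm_ring_1"
  assumes "prime CHAR('a)" "q = CHAR('a) ^ s"
  shows "frob_sum q N x ^ q = frob_sum q N x + x ^ (q ^ N) - x"
proof -
  have "frob_sum q N x ^ q = (\<Sum>i<N. x ^ (q ^ Suc i))"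
    unfolding frob_sum_def freshmans_dream_sum'[OF assms] by (simp flip: power_mult add: mult.commute)
  also have "x + \<dots> = (\<Sum>i<Suc N. x ^ (q ^ i))"
    by (subst sum.lessThan_Suc_shift) simp
  finally show ?thesis by (simp add: frob_sum_def algebra_simps)
qed

text \<open>Iterate x^q = x + w. With base p this yields the translation of an Artin-Schreier root
  by the trace of w.\<close>

lemma frob_sum_artin_schreier:
  fixes x :: "'a::comm_ring_1"
  assumes "prime CHAR('a)" "q = CHAR('a) ^ s" "x ^ q - x = w"
  shows "x ^ (q ^ l) = x + frob_sum q l w"
proof (induction l)
  case (Suc l)
  have q: "q ^ l = CHAR('a) ^ (s * l)" using assms by (simp add: power_mult)
  have "x ^ (q ^ Suc l) = (x + w) ^ (q ^ l)"
    using assms(3) by (auto simp: power_mult)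
  also have "\<dots> = x ^ (q ^ l) + w ^ (q ^ l)"
    using assms(1) q by (rule freshmans_dream')
  finally show ?case using Suc by (simp add: frob_sum_def)
qed (simp add: frob_sum_def)

section \<open>Logarithmic derivatives and Artin-Schreier conjugates\<close>

lemma poly_pderiv_prod:
  fixes f :: "'b \<Rightarrow> 'a::field poly"
  assumes "finite A" "\<And>i. i \<in> A \<Longrightarrow> poly (f i) x \<noteq> 0"
  shows "poly (pderiv (\<Prod>i\<in>A. f i)) x =
    poly (\<Prod>i\<in>A. f i) x * (\<Sum>i\<in>A. poly (pderiv (f i)) x / poly (f i) x)"
  using assms by (induction A rule: finite_induct) (auto simp: pderiv_mult field_simps)

text \<open>The elements b t with b < p are the p roots of S = X^p - X, a set closed under negation,
  so S is the product of the X + b t. Since S' = -1, the logarithmic derivative of S at x is -1 /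
  (x^p - x).\<close>

lemma sum_inverse_artin_schreier:
  fixes x t :: "'a::field"
  assumes "prime CHAR('a)" "p = CHAR('a)" "t ^ p = t" "t \<noteq> 0" "x ^ p \<noteq> x"
  shows "(\<Sum>b<p. 1 / (x + of_nat b * t)) = - 1 / (x ^ p - x)"
proof -
  define S :: "'a poly" where "S = monom 1 p - monom 1 1"
  have p2: "p \<ge> 2" using assms prime_ge_2_nat by simp
  have inj: "inj_on (\<lambda>b. of_nat b * t) {..<p}"
    using assms by (auto simp: inj_on_def of_nat_eq_iff_cong_CHAR cong_def)
  have deg: "degree S \<le> p"
    unfolding S_def using p2 by (intro degree_diff_le) (simp_all add: degree_monom_eq)
  have lc: "coeff S p = 1" using p2 by (simp add: S_def)
  have "S = (\<Prod>b<p. [:of_nat b * t, 1:])"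
  proof (rule poly_eqI_degree_lead_coeff[of _ p])
    have lcp: "lead_coeff (\<Prod>b<p. [:of_nat b * t, 1:]) = 1"
      by (simp add: lead_coeff_prod)
    have degp: "degree (\<Prod>b<p. [:of_nat b * t, 1:]) = p"
      by (subst degree_prod_eq_sum_degree) auto
    show "coeff S p = coeff (\<Prod>b<p. [:of_nat b * t, 1:]) p" using lc lcp degp by simp
    show "degree (\<Prod>b<p. [:of_nat b * t, 1:]) \<le> p" using degp by simp
    show "degree S \<le> p" using deg .
    show "p \<le> card ((\<lambda>b. - (of_nat b * t)) ` {..<p})"
      using inj by (subst card_image) (auto simp: inj_on_def)
    fix z assume "z \<in> (\<lambda>b. - (of_nat b * t)) ` {..<p}"
    then obtain b where b: "b < p" "z = - (of_nat b * t)" by auto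
    have "z ^ p = - ((of_nat b * t) ^ p)"
      unfolding b(2) by (rule power_char_uminus[where s = 1]) (use assms in auto)
    also have "\<dots> = z"
      using assms power_char_of_nat[of b] b by (simp add: power_mult_distrib)
    finally have "poly S z = 0" by (simp add: S_def poly_monom)
    moreover have "poly (\<Prod>b<p. [:of_nat b * t, 1:]) z = 0"
      using b by (auto simp: poly_prod)
    ultimately show "poly S z = poly (\<Prod>b<p. [:of_nat b * t, 1:]) z" by simp
  qed
  moreover have "poly S x \<noteq> 0" using assms by (simp add: S_def poly_monom)
  ultimately have "poly (pderiv S) x = poly S x * (\<Sum>b<p. 1 / (of_nat b * t + x))"
    using poly_pderiv_prod[of "{..<p}" "\<lambda>b. [:of_nat b * t, 1:]" x]
    by (simp add: poly_prod pderiv_pCons)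
  moreover have "poly (pderiv S) x = - 1"
    using assms by (simp add: S_def pderiv_diff pderiv_monom poly_monom)
  ultimately show ?thesis
    using \<open>poly S x \<noteq> 0\<close> by (simp add: S_def poly_monom field_simps)
qed

subsection \<open>The conjugate polynomial and its gcd with \<open>x\<^sup>N - 1\<close>\<close>

text \<open>The second argument of the gcd in \<open>k_normal\<close>, with the base kept free. Its
  value at 1 is the trace, which is how traces control the multiplicity at 1.\<close>

definition conj_poly :: "nat \<Rightarrow> nat \<Rightarrow> 'a::comm_semiring_1 \<Rightarrow> 'a poly" where
  "conj_poly q N x = (\<Sum>i<N. monom (x ^ (q ^ i)) (N - 1 - i))"

lemma poly_conj_poly_1: "poly (conj_poly q N x) 1 = frob_sum q N x"
  by (simp add: conj_poly_def frob_sum_def poly_sum poly_monom)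

lemma monom_minus_1_dvd:
  "monom 1 N - 1 dvd (monom c (a * N + d) - monom c d :: 'a::comm_ring_1 poly)"
proof -
  have "monom 1 N - 1 dvd (monom 1 N ^ a - 1 :: 'a poly)"
    by (metis dvd_triv_left power_diff_1_eq)
  hence "monom 1 N - 1 dvd monom c d * (monom 1 N ^ a - 1 :: 'a poly)" by simp
  also have "monom c d * (monom 1 N ^ a - 1) = monom c (a * N + d) - monom c d"
    by (simp add: monom_power mult_monom algebra_simps)
  finally show ?thesis .
qed

text \<open>Exponents count only modulo N: term j N + i lands on exponent N - 1 - i, and for fixed i
  the coefficients add up over j to the q^i-th power of the relative trace.\<close>

lemma conj_poly_cong:
  fixes x :: "'a::comm_ring_1"
  assumes "prime CHAR('a)" "q = CHAR('a) ^ s"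
  shows "monom 1 N - 1 dvd conj_poly q (N * b) x - conj_poly q N (frob_sum (q ^ N) b x)"
proof -
  let ?c = "\<lambda>i j. x ^ (q ^ (j * N + i))"
  have q: "q ^ i = CHAR('a) ^ (s * i)" for i using assms by (simp add: power_mult)
  have "conj_poly q (N * b) x = (\<Sum>j<b. \<Sum>i<N. monom (?c i j) (N * b - 1 - (j * N + i)))"
    by (simp add: conj_poly_def sum_lessThan_mult)
  also have "\<dots> = (\<Sum>j<b. \<Sum>i<N. monom (?c i j) ((b - 1 - j) * N + (N - 1 - i)))"
  proof (intro sum.cong refl)
    fix i j assume "j \<in> {..<b}" "i \<in> {..<N}"
    then obtain b' N' where "b = Suc (j + b')" "N = Suc (i + N')"
      by (metis lessThan_iff less_imp_Suc_add)
    thus "monom (?c i j) (N * b - 1 - (j * N + i)) =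
        monom (?c i j) ((b - 1 - j) * N + (N - 1 - i))"
      by (simp add: algebra_simps)
  qed
  finally have 1: "conj_poly q (N * b) x = \<dots>" .
  have "conj_poly q N (frob_sum (q ^ N) b x) =
      (\<Sum>i<N. monom (\<Sum>j<b. (x ^ ((q ^ N) ^ j)) ^ (q ^ i)) (N - 1 - i))"
    by (simp add: conj_poly_def frob_sum_def freshmans_dream_sum'[OF assms(1) q])
  also have "\<dots> = (\<Sum>i<N. \<Sum>j<b. monom (?c i j) (N - 1 - i))"
    by (intro sum.cong refl)
      (simp add: monom_sum power_add flip: power_mult, simp add: mult_ac)
  also have "\<dots> = (\<Sum>j<b. \<Sum>i<N. monom (?c i j) (N - 1 - i))"
    by (rule sum.swap)
  finally have 2: "conj_poly q N (frob_sum (q ^ N) b x) = \<dots>" .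
  show ?thesis
    unfolding 1 2 sum_subtractf[symmetric] by (intro dvd_sum monom_minus_1_dvd)
qed

section \<open>Comparing multiplicities of zeros\<close>

lemma order_gcd:
  fixes f g :: "'a::{field, factorial_ring_gcd, semiring_gcd_mult_normalize} poly"
  assumes "f \<noteq> 0" "g \<noteq> 0"
  shows "order x (gcd f g) = min (order x f) (order x g)"
proof (rule antisym)
  show "order x (gcd f g) \<le> min (order x f) (order x g)"
    using assms by (simp add: dvd_imp_order_le)
  have "[:- x, 1:] ^ min (order x f) (order x g) dvd gcd f g"
    by (intro gcd_greatest) (simp_all add: order_divides)
  from this[unfolded order_divides]
  show "min (order x f) (order x g) \<le> order x (gcd f g)"
    using assms by auto
qed

lemma size_proots_alg_closed:
  fixes f :: "'a::alg_closed_field poly"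
  shows "size (proots f) = degree f"
proof (cases "f = 0")
  case False
  then obtain A where A: "size A = degree f" "f = smult (lead_coeff f) (\<Prod>x\<in>#A. [:- x, 1:])"
    using alg_closed_imp_factorization by blast
  have "proots (\<Prod>x\<in>#A. [:- x, 1:]) = A"
  proof (induction A)
    case (add x A)
    have "(\<Prod>x\<in>#A. [:- x, 1:]) \<noteq> 0" by (auto simp: prod_mset_zero_iff)
    with add show ?case by (simp add: proots_mult del: mult_pCons_left)
  qed simp
  with A False show ?thesis by (metis leading_coeff_0_iff proots_smult)
qed simp

text \<open>The degree counts the zeros with multiplicity, so two gcds can be compared one zero at a
  time.\<close>

lemma degree_eq_if_order_eq:
  fixes f g :: "'a::alg_closed_field poly"
  assumes "f \<noteq> 0" "g \<noteq> 0" "\<And>x. order x f = order x g"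
  shows "degree f = degree g"
proof -
  have "proots f = proots g" using assms by (intro multiset_eqI) simp
  thus ?thesis by (metis size_proots_alg_closed)
qed

text \<open>The subtracted sum, (X^N - 1) / (X - 1), is the contribution of the constant 1, whose
  conjugates are all 1.\<close>

lemma conj_poly_scale_diff_1:
  fixes c x :: "'a::comm_ring_1"
  assumes "prime CHAR('a)" "q = CHAR('a) ^ s" "c ^ q = c"
  shows "conj_poly q N (c * (x - 1)) = smult c (conj_poly q N x - (\<Sum>i<N. monom 1 i))"
proof -
  have q: "q ^ i = CHAR('a) ^ (s * i)" for i using assms by (simp add: power_mult)
  have smult_sum: "smult c (\<Sum>i\<in>I. f i) = (\<Sum>i\<in>I. smult c (f i))"
    for f :: "nat \<Rightarrow> 'a poly" and I
    by (induction I rule: infinite_finite_induct) (simp_all add: smult_add_right)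
  have "conj_poly q N (c * (x - 1)) = (\<Sum>i<N. monom (c * (x ^ (q ^ i) - 1)) (N - 1 - i))"
    using power_char_diff[OF assms(1) q] power_power_fixed[OF assms(3)]
    by (simp add: conj_poly_def power_mult_distrib)
  also have "\<dots> = smult c (conj_poly q N x - (\<Sum>i<N. monom 1 (N - Suc i)))"
    by (simp add: conj_poly_def smult_diff_right smult_monom sum_subtractf right_diff_distrib
        smult_sum flip: diff_monom)
  also have "(\<Sum>i<N. monom 1 (N - Suc i)) = (\<Sum>i<N. monom 1 i :: 'a poly)"
    by (rule sum.nat_diff_reindex)
  finally show ?thesis .
qed

text \<open>With N = Q M, additivity of the Q-th power gives X^N - 1 = (X^M - 1)^Q, and its
  injectivity gives \<open>\<zeta> ^ M = 1\<close>.\<close>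

lemma root_of_unity_power_dvd:
  fixes \<zeta> :: "'a::idom"
  assumes "prime CHAR('a)" "Q = CHAR('a) ^ e" "Q dvd N" "\<zeta> ^ N = 1"
  shows "[:- \<zeta>, 1:] ^ Q dvd monom 1 N - 1"
proof -
  obtain M where N: "N = Q * M" using assms(3) by blast
  have "(\<zeta> ^ M) ^ Q = 1 ^ Q" using assms(4) N by (simp add: mult.commute flip: power_mult)
  hence "\<zeta> ^ M = 1" by (simp only: power_char_eq_iff[OF assms(1,2)])
  hence "poly (monom 1 M - 1) \<zeta> = 0" by (simp add: poly_monom)
  hence "[:- \<zeta>, 1:] ^ Q dvd (monom 1 M - 1) ^ Q" by (intro dvd_power_same) (simp only: poly_eq_0_iff_dvd)
  also have "(monom 1 M - 1) ^ Q = monom 1 M ^ Q - (1 ^ Q :: 'a poly)"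
    by (rule power_char_diff[where s = e]) (use assms in simp_all)
  also have "\<dots> = monom 1 N - 1" by (simp add: N monom_power mult.commute)
  finally show ?thesis .
qed

text \<open>A multiplicity below Q can be read off modulo (X - x)^Q, where f agrees with c
  g.\<close>

lemma order_eq_if_cong:
  fixes f g :: "'a::idom poly"
  assumes "[:- x, 1:] ^ Q dvd f - smult c g" "g \<noteq> 0" "c \<noteq> 0" "f \<noteq> 0" "order x g < Q"
  shows "order x f = order x g"
proof (rule order_unique_lemma)
  let ?X = "[:- x, 1:]"
  have le: "?X ^ l dvd f - smult c g" if "l \<le> Q" for l
    using assms(1) that power_le_dvd by blast
  have iff: "?X ^ l dvd f \<longleftrightarrow> ?X ^ l dvd smult c g" if "l \<le> Q" for l
    using le[OF that] by (metis diff_add_cancel dvd_add_right_iff)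
  have "order x (smult c g) = order x g" using assms by (simp add: order_smult)
  hence "?X ^ l dvd smult c g \<longleftrightarrow> l \<le> order x g" for l
    using assms by (subst order_divides) auto
  thus "?X ^ order x g dvd f" "\<not> ?X ^ Suc (order x g) dvd f"
    using iff[of "order x g"] iff[of "Suc (order x g)"] assms(5) by (simp_all del: power_Suc)
qed

lemma monom_minus_1_neq_0: "N > 0 \<Longrightarrow> monom 1 N - 1 \<noteq> (0 :: 'a::comm_ring_1 poly)"
proof
  assume "N > 0" "monom 1 N - 1 = (0 :: 'a poly)"
  hence "coeff (monom 1 N - 1 :: 'a poly) N = 0" by simp
  with \<open>N > 0\<close> show False by simp
qed

text \<open>The two gcds have equal multiplicity at every z. Zeros of X^N - 1 other than 1 are
  settled by the congruence, z = 1 by the nonzero traces, and any other z is a zero of neither X^N -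
  1 nor X^(N p) - 1.\<close>

lemma degree_gcd_conj_poly_extend:
  fixes x y c :: "'a::{alg_closed_field, factorial_ring_gcd, semiring_gcd_mult_normalize}"
  assumes "prime CHAR('a)" "q = CHAR('a) ^ s" "Q = CHAR('a) ^ e" "Q dvd N" "N > 0"
    and p: "p = CHAR('a) ^ t"
    and tr: "frob_sum (q ^ N) p y = c * (x - 1)" and c: "c \<noteq> 0" "c ^ q = c"
    and x: "frob_sum q N x \<noteq> 0" and y: "frob_sum q (N * p) y \<noteq> 0"
    and less: "degree (gcd (monom 1 N - 1) (conj_poly q N x)) < Q"
  shows "degree (gcd (monom 1 (N * p) - 1) (conj_poly q (N * p) y)) =
    degree (gcd (monom 1 N - 1) (conj_poly q N x))"
proof -
  have p0: "p > 0" using assms by (simp add: prime_gt_0_nat)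
  let ?X = "monom 1 N - 1 :: 'a poly" and ?Y = "monom 1 (N * p) - 1 :: 'a poly"
  let ?G = "conj_poly q N x" and ?H = "conj_poly q (N * p) y"
  let ?S = "\<Sum>i<N. monom 1 i :: 'a poly"
  \<comment> \<open>\<open>order\<close> is informative only for nonzero polynomials;
    \<open>?G\<close> and \<open>?H\<close> are nonzero because their values at 1 are the
    traces.\<close>
  have nz: "?X \<noteq> 0" "?Y \<noteq> 0" "?G \<noteq> 0" "?H \<noteq> 0"
    using \<open>N > 0\<close> p0 x y poly_conj_poly_1[of q N x] poly_conj_poly_1[of q "N * p" y]
    by (auto simp del: right_minus_eq intro!: monom_minus_1_neq_0)
  have XY: "?X dvd ?Y"
    using monom_minus_1_dvd[of N 1 p 0] by (simp add: mult.commute)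
  have cong: "?X dvd ?H - smult c (?G - ?S)"
    using conj_poly_cong[OF assms(1,2), of N p y] conj_poly_scale_diff_1[OF assms(1,2) c(2)]
    by (simp add: tr)
  have "order z (gcd ?Y ?H) = order z (gcd ?X ?G)" for z
  proof (cases "z ^ N = 1 \<and> z \<noteq> 1")
    case True
    hence dvd: "[:- z, 1:] ^ Q dvd ?X"
      using root_of_unity_power_dvd assms by blast
    hence oX: "Q \<le> order z ?X" using nz by (simp add: order_divides)
    hence oY: "Q \<le> order z ?Y" using dvd_imp_order_le[OF nz(2) XY, of z] by simp
    \<comment> \<open>The multiplicity in the gcd is at most its degree, hence below Q. As
      \<open>?X\<close> has multiplicity at least Q at z, the minimum is attained by
      \<open>?G\<close>.\<close>
    have "order z (gcd ?X ?G) < Q"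
      using less order_degree[of "gcd ?X ?G" z] nz by (simp add: le_less_trans)
    hence oG: "order z ?G < Q" using oX nz by (simp add: order_gcd)
    \<comment> \<open>\<open>?X\<close> is X - 1 times \<open>?S\<close>; since z is not 1,
      \<open>?S\<close> keeps multiplicity at least Q at z and drops out of the congruence.\<close>
    have "monom 1 1 - 1 = ([:- 1, 1:] :: 'a poly)"
      by (simp add: monom_altdef one_pCons)
    with power_diff_1_eq[of "monom 1 1 :: 'a poly" N] have "?X = [:- 1, 1:] * ?S"
      by (simp add: monom_power)
    hence "order z ?X = order z [:- 1, 1:] + order z ?S"
      using nz by (metis order_mult)
    moreover have "order z [:- 1, 1:] = 0" using True by (intro order_0I) auto
    ultimately have "[:- z, 1:] ^ Q dvd ?S" using oX by (simp add: order_divides)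
    with dvd cong have "[:- z, 1:] ^ Q dvd (?H - smult c (?G - ?S)) - smult c ?S"
      by (meson dvd_diff dvd_smult dvd_trans)
    hence "[:- z, 1:] ^ Q dvd ?H - smult c ?G" by (simp add: smult_diff_right)
    hence "order z ?H = order z ?G"
      using nz oG c by (intro order_eq_if_cong) auto
    thus ?thesis using nz oG oX oY by (simp add: order_gcd)
  next
    case False
    have "order z (gcd ?X ?G) = 0"
    proof (cases "z = 1")
      case True
      thus ?thesis using nz x by (simp add: order_gcd order_0I poly_conj_poly_1)
    next
      case z: False
      thus ?thesis using nz False by (simp add: order_gcd order_0I poly_monom)
    qed
    moreover have "order z (gcd ?Y ?H) = 0"
    proof (cases "z = 1")
      case True
      thus ?thesis using nz y by (simp add: order_gcd order_0I poly_conj_poly_1)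
    next
      case z: False
      with False have "z ^ N \<noteq> 1" by simp
      \<comment> \<open>Taking p-th powers is injective, so no new zeros appear in X^(N p) -
        1.\<close>
      hence "z ^ (N * p) \<noteq> 1"
        using power_char_eq_iff[OF assms(1) p, of "z ^ N" 1] by (simp add: power_mult)
      thus ?thesis using nz by (simp add: order_gcd order_0I poly_monom)
    qed
    ultimately show ?thesis by simp
  qed
  thus ?thesis using nz by (intro degree_eq_if_order_eq) auto
qed

subsection \<open>One step of the tower\<close>

text \<open>The orbit of x under the q-th power map has length exactly N; over F_q this is the
  degree of x. At N = 0 the equivalence would say that x never returns, hence the condition N >
  0.\<close>

definition frob_degree :: "nat \<Rightarrow> nat \<Rightarrow> 'a::field \<Rightarrow> bool" where
  "frob_degree q N x \<longleftrightarrow> N > 0 \<and> (\<forall>i. x ^ (q ^ i) = x \<longleftrightarrow> N dvd i)"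

lemma frob_degreeD: "frob_degree q N x \<Longrightarrow> x ^ (q ^ i) = x \<longleftrightarrow> N dvd i"
  by (simp add: frob_degree_def)

lemma frob_degree_inverse: "frob_degree q N (inverse x) \<longleftrightarrow> frob_degree q N x"
  by (simp add: frob_degree_def power_inverse)

lemma frob_degree_inj:
  assumes "frob_degree q N x" "prime CHAR('a)" "q = CHAR('a) ^ s"
  shows "inj_on (\<lambda>i. (x::'a::field) ^ (q ^ i)) {..<N}"
proof (rule linorder_inj_onI')
  fix i j assume ij: "i \<in> {..<N}" "j \<in> {..<N}" "i < j"
  have "x ^ (q ^ j) = (x ^ (q ^ (j - i))) ^ (q ^ i)"
    using ij by (simp flip: power_mult power_add)
  moreover have "q ^ i = CHAR('a) ^ (s * i)" using assms by (simp add: power_mult)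
  ultimately have "x ^ (q ^ i) = x ^ (q ^ j) \<longleftrightarrow> x = x ^ (q ^ (j - i))"
    using power_char_eq_iff[OF assms(2)] by metis
  moreover have "\<not> N dvd j - i" using ij by (auto dest: dvd_imp_le)
  ultimately show "x ^ (q ^ i) \<noteq> x ^ (q ^ j)" using frob_degreeD[OF assms(1)] by metis
qed

text \<open>In the tower x is a root of the reciprocal of F_u, d is \<delta>, and 1/y is a root of
  the reciprocal of F_(u+1). Absolute traces have s N terms because q^N = p^(s N). That p divides N
  makes the trace of 1 vanish.\<close>

locale artin_schreier_step =
  fixes p q s N :: nat and x y d w :: "'a::field"
  assumes prime: "prime CHAR('a)" and p: "p = CHAR('a)" and q: "q = p ^ s"
    and N: "p dvd N" "frob_degree q N x"
    and d: "d ^ p = d" "d \<noteq> 0"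
    and tr: "frob_sum p (s * N) x \<noteq> 0" "frob_sum p (s * N) (1 / (x - 1)) \<noteq> 0"
    and w: "w = d / (x - 1)" and y: "y ^ p - y = w"
begin

text \<open>The amount by which the q^N-th power map translates y. It is a nonzero element of F_p,
  so the orbit of y under that map has p elements.\<close>

definition t where "t = frob_sum p (s * N) w"

lemma p_gt_0: "p > 0" using prime p by (simp add: prime_gt_0_nat)

text \<open>Since 1 / 0 = 0, x = 1 would make the second trace in \<open>tr\<close> the trace of
  0.\<close>

lemma x_neq_1: "x \<noteq> 1" using tr p_gt_0 by (auto simp: frob_sum_def power_0_left)

lemma w_neq_0: "w \<noteq> 0" using w d x_neq_1 by simp

lemma t_neq_0: "t \<noteq> 0"
  using tr d frob_sum_scale[OF d(1), of "s * N" "1 / (x - 1)"] unfolding t_def unfolding w by simp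

lemma q_power: "q ^ i = p ^ (s * i)" by (simp add: q power_mult)

lemma q_power_char: "q ^ i = CHAR('a) ^ (s * i)" by (simp add: q_power p)

lemma p_char: "p = CHAR('a) ^ 1" by (simp add: p)

lemma d_frob: "d ^ (q ^ i) = d"
  using power_power_fixed[OF d(1)] by (simp add: q_power)

text \<open>As d is fixed by Frobenius, w and x are rational functions of each other with fixed
  coefficients, so they have the same periods.\<close>

lemma w_frob: "w ^ (q ^ i) = w \<longleftrightarrow> N dvd i"
proof -
  have "w ^ (q ^ i) = d / (x ^ (q ^ i) - 1)"
    by (simp add: w power_divide power_char_diff[OF prime q_power_char] d_frob)
  also have "\<dots> = w \<longleftrightarrow> x ^ (q ^ i) = x"
    using d by (simp add: w divide_cancel_left)
  finally have "w ^ (q ^ i) = w \<longleftrightarrow> x ^ (q ^ i) = x" .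
  thus ?thesis using frob_degreeD[OF N(2)] by simp
qed

lemma t_frob: "t ^ p = t"
  using frob_sum_power[OF prime p_char, of "s * N" w] w_frob[of N]
  by (simp add: t_def q_power)

lemma y_frob_mult: "y ^ (q ^ (N * j)) = y + of_nat j * t"
proof (induction j)
  case (Suc j)
  have t: "t ^ (q ^ N) = t" using power_power_fixed[OF t_frob] by (simp add: q_power)
  have j: "of_nat j ^ (q ^ N) = (of_nat j :: 'a)"
    using power_power_fixed[OF power_char_of_nat[OF prime]] by (simp add: q_power p)
  have "q ^ (N * Suc j) = q ^ (N * j) * q ^ N" by (simp add: power_add)
  hence "y ^ (q ^ (N * Suc j)) = (y + of_nat j * t) ^ (q ^ N)"
    by (simp only: power_mult[of y] Suc)
  also have "\<dots> = y ^ (q ^ N) + of_nat j * t"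
    using freshmans_dream'[OF prime q_power_char] by (simp add: power_mult_distrib t j)
  also have "y ^ (q ^ N) = y + t"
    using frob_sum_artin_schreier[OF prime p_char y] by (simp add: q_power t_def)
  finally show ?case by (simp add: algebra_simps)
qed simp

text \<open>A Frobenius power fixing y fixes w = y^p - y, hence N divides i. For i = N j it
  translates y by j t, which is 0 exactly when p divides j.\<close>

lemma frob_degree_y: "frob_degree q (N * p) y"
  unfolding frob_degree_def
proof (intro conjI allI)
  show "N * p > 0" using N p_gt_0 by (simp add: frob_degree_def)
  fix i
  show "y ^ (q ^ i) = y \<longleftrightarrow> N * p dvd i"
  proof (cases "N dvd i")
    case True
    then obtain j where "i = N * j" by blast
    moreover have "N > 0" using N by (simp add: frob_degree_def)
    ultimately show ?thesis
      using t_neq_0 by (simp add: y_frob_mult of_nat_eq_0_iff_char_dvd p)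
  next
    case False
    have "(y ^ p - y) ^ (q ^ i) = (y ^ (q ^ i)) ^ p - y ^ (q ^ i)"
      by (simp add: power_char_diff[OF prime q_power_char] mult.commute flip: power_mult)
    with y False w_frob[of i] have "y ^ (q ^ i) \<noteq> y" by auto
    thus ?thesis using False by (auto dest: dvd_mult_left)
  qed
qed

lemma AS_neq: "y ^ p \<noteq> y" "(1 - y) ^ p \<noteq> 1 - y"
  using y w_neq_0 by (auto simp: power_char_diff[OF prime p_char])

lemma y_neq: "y \<noteq> 0" "y \<noteq> 1"
  using AS_neq p_gt_0 by auto

text \<open>The conjugates are the y + b t, so their inverses sum to -1 / w.\<close>

lemma trace_inverse: "frob_sum (q ^ N) p (1 / y) = - (1 / d) * (x - 1)"
proof -
  have "frob_sum (q ^ N) p (1 / y) = (\<Sum>b<p. 1 / (y + of_nat b * t))"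
    by (simp add: frob_sum_def power_divide y_frob_mult flip: power_mult)
  also have "\<dots> = - 1 / (y ^ p - y)"
    using prime p t_frob t_neq_0 AS_neq(1) by (rule sum_inverse_artin_schreier)
  finally show ?thesis using d by (simp add: y w divide_simps)
qed

text \<open>As 1 / (1/y - 1) = 1 / (1 - y) - 1, the p copies of -1 cancel, and 1 - y is an
  Artin-Schreier root for -w with translation -t.\<close>

lemma trace_inverse_shift: "frob_sum (q ^ N) p (1 / (1 / y - 1)) = (1 / d) * (x - 1)"
proof -
  have neg_t: "(- t) ^ p = - t"
    by (simp only: power_char_uminus[OF prime p_char] t_frob)
  have "frob_sum (q ^ N) p (1 / (1 / y - 1)) = (\<Sum>b<p. (1 / (1 / y - 1)) ^ (q ^ (N * b)))"
    by (simp add: frob_sum_def power_mult)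
  also have "\<dots> = (\<Sum>b<p. 1 / ((1 - y) + of_nat b * (- t)) - 1)"
  proof (rule sum.cong[OF refl])
    fix b
    let ?z = "y + of_nat b * t"
    have z: "?z = y ^ (q ^ (N * b))" by (rule y_frob_mult[symmetric])
    have "(1 / (1 / y - 1)) ^ (q ^ (N * b)) = 1 / (1 / ?z - 1)"
      by (simp add: power_divide power_char_diff[OF prime q_power_char] z)
    also have "?z \<noteq> 0" "?z \<noteq> 1"
      using y_neq power_char_eq_iff[OF prime q_power_char[of "N * b"], of y 1] unfolding z by auto
    hence "1 / (1 / ?z - 1) = 1 / (1 - ?z) - 1" by (simp add: field_simps)
    finally show "(1 / (1 / y - 1)) ^ (q ^ (N * b)) = 1 / ((1 - y) + of_nat b * (- t)) - 1"
      by (simp add: algebra_simps)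
  qed
  also have "\<dots> = (\<Sum>b<p. 1 / ((1 - y) + of_nat b * (- t)))"
    by (simp add: sum_subtractf p)
  also have "\<dots> = - 1 / ((1 - y) ^ p - (1 - y))"
    using t_neq_0 AS_neq(2) neg_t by (intro sum_inverse_artin_schreier[OF prime p]) simp_all
  also have "(1 - y) ^ p - (1 - y) = - w"
    by (simp add: power_char_diff[OF prime p_char] flip: y)
  finally show ?thesis using d by (simp add: w divide_simps)
qed

lemma frob_sum_tower:
  "frob_sum p (s * (N * p)) (z :: 'a) = frob_sum p (s * N) (frob_sum (q ^ N) p z)"
  using frob_sum_mult[OF prime p_char, of "s * N" p z] by (simp add: q_power mult.assoc)

lemma frob_sum_x_minus_1:
  assumes "c ^ p = c"
  shows "frob_sum p (s * N) (c * (x - 1)) = c * frob_sum p (s * N) x"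
proof -
  have "frob_sum p (s * N) 1 = (0 :: 'a)"
    using N(1) by (simp add: frob_sum_def of_nat_eq_0_iff_char_dvd p)
  hence "frob_sum p (s * N) (x - 1) = frob_sum p (s * N) x"
    using frob_sum_add[OF prime p_char, of "s * N" "x - 1" 1] by simp
  thus ?thesis using frob_sum_scale[OF assms] by simp
qed

lemma inverse_d_frob: "(1 / d) ^ p = 1 / d" "(- (1 / d)) ^ p = - (1 / d)"
  using d by (simp_all add: power_char_uminus[OF prime p_char] power_divide)

text \<open>Both are the absolute trace of x times 1/d up to sign, so the pair of conditions in
  \<open>tr\<close> passes from x to 1/y.\<close>

lemma trace_y_neq_0:
  "frob_sum p (s * (N * p)) (1 / y) \<noteq> 0"
  "frob_sum p (s * (N * p)) (1 / (1 / y - 1)) \<noteq> 0"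
  unfolding frob_sum_tower trace_inverse trace_inverse_shift inverse_d_frob[THEN frob_sum_x_minus_1]
  using tr(1) d by simp_all

lemma frob_sum_neq_0:
  assumes "frob_sum p (s * M) z \<noteq> (0::'a)"
  shows "frob_sum q M z \<noteq> 0"
proof
  assume "frob_sum q M z = 0"
  hence "frob_sum p (s * M) z = 0"
    using frob_sum_mult[OF prime p_char, of s M z] p_gt_0 by (simp add: q frob_sum_def power_0_left)
  with assms show False by simp
qed

end

lemma degree_gcd_artin_schreier:
  fixes x y d w :: "'a::{alg_closed_field, factorial_ring_gcd, semiring_gcd_mult_normalize}"
  assumes "artin_schreier_step p q s N x y d w" "p ^ e dvd N"
    and "degree (gcd (monom 1 N - 1) (conj_poly q N x)) < p ^ e"
  shows "degree (gcd (monom 1 (N * p) - 1) (conj_poly q (N * p) (1 / y))) =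
    degree (gcd (monom 1 N - 1) (conj_poly q N x))"
proof -
  interpret artin_schreier_step p q s N x y d w by fact
  have "q = CHAR('a) ^ s" "p ^ e = CHAR('a) ^ e" using q p by simp_all
  moreover have "N > 0" using N by (simp add: frob_degree_def)
  moreover have "- (1 / d) \<noteq> 0" "(- (1 / d)) ^ q = - (1 / d)"
    using d power_power_fixed[OF inverse_d_frob(2)] by (simp_all add: q)
  moreover have "frob_sum q N x \<noteq> 0" "frob_sum q (N * p) (1 / y) \<noteq> 0"
    using frob_sum_neq_0 tr(1) trace_y_neq_0(1) by blast+
  ultimately show ?thesis
    by (rule degree_gcd_conj_poly_extend[OF prime _ _ assms(2) _ p_char trace_inverse
          _ _ _ _ assms(3)])
qed

subsection \<open>Polynomials over a finite field and their roots in the algebraic closure\<close>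

lemma map_poly_hom_mult:
  fixes f g :: "'a::comm_semiring_1 poly" and h :: "'a \<Rightarrow> 'b::comm_semiring_1"
  assumes "h 0 = 0" "\<And>x y. h (x + y) = h x + h y" "\<And>x y. h (x * y) = h x * h y"
  shows "map_poly h (f * g) = map_poly h f * map_poly h g"
proof (rule poly_eqI)
  fix n
  have sum: "h (sum k I) = (\<Sum>i\<in>I. h (k i))" for k :: "nat \<Rightarrow> 'a" and I
    using assms by (induction I rule: infinite_finite_induct) simp_all
  show "coeff (map_poly h (f * g)) n = coeff (map_poly h f * map_poly h g) n"
    using assms by (simp add: coeff_map_poly coeff_mult sum)
qed

lemma map_poly_hom_prod:
  fixes f :: "'c \<Rightarrow> 'a::comm_semiring_1 poly" and h :: "'a \<Rightarrow> 'b::comm_semiring_1"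
  assumes "h 0 = 0" "h 1 = 1" "\<And>x y. h (x + y) = h x + h y" "\<And>x y. h (x * y) = h x * h y"
  shows "map_poly h (\<Prod>i\<in>I. f i) = (\<Prod>i\<in>I. map_poly h (f i))"
  using assms by (induction I rule: infinite_finite_induct) (simp_all add: map_poly_hom_mult)

lemma prime_CHAR_finite_field: "prime CHAR('a::finite_field)"
  using CHAR_pos prime_CHAR_semidom by blast

lemma CHAR_eq_if_CARD_eq_power:
  assumes "prime p" "CARD('a::finite_field) = p ^ m"
  shows "CHAR('a) = p"
  using assms CHAR_dvd_CARD[where 'a = 'a] prime_CHAR_finite_field[where 'a = 'a]
    prime_dvd_power primes_dvd_imp_eq by metis

lemma degree_map_to_ac [simp]: "degree (map_poly to_ac f) = degree f"
  by (rule degree_map_poly) simp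

lemma map_to_ac_eq_0_iff [simp]: "map_poly to_ac f = 0 \<longleftrightarrow> f = 0"
  by (intro map_poly_eq_0_iff) auto

lemma map_to_ac_mult: "map_poly to_ac (f * g) = map_poly to_ac f * map_poly to_ac g"
  by (rule map_poly_hom_mult) simp_all

lemma map_to_ac_add: "map_poly to_ac (f + g) = map_poly to_ac f + map_poly to_ac g"
  by (rule poly_eqI) (simp add: coeff_map_poly)

lemma map_to_ac_smult: "map_poly to_ac (smult c f) = smult (to_ac c) (map_poly to_ac f)"
  by (rule map_poly_smult) simp_all

lemma map_to_ac_diff: "map_poly to_ac (f - g) = map_poly to_ac f - map_poly to_ac g"
  by (rule poly_eqI) (simp add: coeff_map_poly)

lemma map_to_ac_power: "map_poly to_ac (f ^ i) = map_poly to_ac f ^ i"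
  by (induction i) (simp_all add: map_to_ac_mult)

lemma map_to_ac_sum: "map_poly to_ac (sum f I) = (\<Sum>i\<in>I. map_poly to_ac (f i))"
  by (induction I rule: infinite_finite_induct) (simp_all add: map_to_ac_add)

lemma map_to_ac_reflect: "map_poly to_ac (reflect_poly f) = reflect_poly (map_poly to_ac f)"
  by (rule poly_eqI) (simp add: coeff_map_poly coeff_reflect_poly)

lemma map_to_ac_pderiv: "map_poly to_ac (pderiv f) = pderiv (map_poly to_ac f)"
  by (rule poly_eqI) (simp add: coeff_map_poly coeff_pderiv)

lemma poly_map_to_ac: "poly (map_poly to_ac f) (to_ac x) = to_ac (poly f x)"
  by (induction f) (simp_all add: map_poly_pCons)

section \<open>Finite fields and Frobenius inside the algebraic closure\<close>

locale frobenius =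
  fixes p m :: nat and ty :: "'a::finite_field itself"
  assumes prime: "prime p" and m: "m \<ge> 1" and card: "CARD('a) = p ^ m"
begin

abbreviation "q \<equiv> p ^ m"

lemma char: "CHAR('a) = p" "CHAR('a alg_closure) = p"
  using CHAR_eq_if_CARD_eq_power[OF prime card] by simp_all

lemma prime_char: "prime CHAR('a alg_closure)" by (simp only: char prime)

lemma q_char: "q = CHAR('a alg_closure) ^ m" by (simp only: char)

lemma q_power_char: "q ^ i = CHAR('a alg_closure) ^ (m * i)" by (simp only: char power_mult)

lemma q_gt_1: "q > 1" using prime_gt_1_nat[OF prime] m by (intro one_less_power) auto

lemma p_gt_0 [simp]: "p > 0" "p \<noteq> 0" using prime prime_gt_0_nat[of p] by auto

lemma frob_eq_iff: "x ^ (q ^ i) = y ^ (q ^ i) \<longleftrightarrow> x = (y::'a alg_closure)"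
  by (rule power_char_eq_iff[OF prime_char q_power_char])

text \<open>The image has q elements, all roots of X^q - X, which has at most q roots.\<close>

lemma range_to_ac: "range (to_ac :: 'a \<Rightarrow> _) = {x. x ^ q = x}"
proof (rule card_seteq)
  let ?f = "monom 1 q - monom 1 1 :: 'a alg_closure poly"
  have "coeff ?f q = 1" using q_gt_1 by auto
  hence "?f \<noteq> 0" by (metis coeff_0 zero_neq_one)
  moreover have "{x. x ^ q = x} = {x. poly ?f x = 0}" by (simp add: poly_monom)
  moreover have "degree ?f \<le> q" using q_gt_1 by (intro degree_diff_le) (simp_all add: degree_monom_eq)
  ultimately show "finite {x :: 'a alg_closure. x ^ q = x}"
    "card {x :: 'a alg_closure. x ^ q = x} \<le> card (range (to_ac :: 'a \<Rightarrow> _))"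
    using poly_roots_finite[of ?f] card_poly_roots_bound[of ?f]
    by (simp_all add: card_image inj_to_ac card)
  show "range (to_ac :: 'a \<Rightarrow> _) \<subseteq> {x. x ^ q = x}"
    using finite_field_power_card_eq_same by (auto simp flip: to_ac_power card)
qed

lemma to_ac_frob: "to_ac (c :: 'a) ^ (q ^ i) = to_ac c"
  using range_to_ac power_power_fixed by blast

lemma poly_frob:
  "poly (map_poly to_ac f) (x ^ (q ^ i)) = poly (map_poly to_ac (f :: 'a poly)) x ^ (q ^ i)"
  by (induction f) (auto simp: map_poly_pCons power_0_left to_ac_frob power_mult_distrib
      freshmans_dream'[OF prime_char q_power_char])

lemma to_ac_poly_if_frob_invariant:
  fixes f :: "'a alg_closure poly"
  assumes "map_poly (\<lambda>c. c ^ q) f = f"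
  shows "\<exists>g :: 'a poly. f = map_poly to_ac g"
proof
  have "coeff f i ^ q = coeff f i" for i
    using arg_cong[OF assms, of "\<lambda>h. coeff h i"] by (simp add: coeff_map_poly power_0_left)
  hence "to_ac (of_ac (coeff f i) :: 'a) = coeff f i" for i
    using range_to_ac by (intro to_ac_of_ac) auto
  thus "f = map_poly to_ac (map_poly of_ac f)" by (intro poly_eqI) (simp add: coeff_map_poly)
qed

text \<open>Frobenius shifts the factors cyclically, so it fixes every coefficient of the product,
  which therefore lies in F_q.\<close>

lemma conjugates_poly:
  fixes x :: "'a alg_closure"
  assumes "x ^ (q ^ d) = x"
  obtains g :: "'a poly" where "map_poly to_ac g = (\<Prod>i<d. [:- (x ^ (q ^ i)), 1:])"
proof -
  let ?f = "\<lambda>i. [:- (x ^ (q ^ i)), 1:]"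
  have "map_poly (\<lambda>c. c ^ q) (\<Prod>i<d. ?f i) = (\<Prod>i<d. map_poly (\<lambda>c. c ^ q) (?f i))"
    using freshmans_dream'[OF prime_char q_char]
    by (intro map_poly_hom_prod) (simp_all add: power_0_left power_mult_distrib)
  also have "\<dots> = (\<Prod>i<d. ?f (Suc i))"
    by (intro prod.cong refl)
      (simp add: map_poly_pCons power_0_left power_char_uminus[OF prime_char q_char] mult.commute
        flip: power_mult)
  \<comment> \<open>Both products extend to the one over d + 1 indices, by index 0 or by index d;
    these two factors agree since x^(q^d) = x.\<close>
  also have "?f 0 * \<dots> = (\<Prod>i<Suc d. ?f i)" by (simp only: prod.lessThan_Suc_shift comp_def)
  hence "(\<Prod>i<d. ?f (Suc i)) = (\<Prod>i<d. ?f i)"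
    using assms by (simp add: mult.commute del: mult_pCons_left mult_pCons_right)
  finally show ?thesis using to_ac_poly_if_frob_invariant that by metis
qed

text \<open>A nonzero polynomial h of least degree vanishing at x divides f by division with
  remainder; irreducibility makes f a constant multiple of h.\<close>

lemma degree_le_if_irreducible:
  fixes f g :: "'a poly"
  assumes "irreducible f" "poly (map_poly to_ac f) x = 0" "g \<noteq> 0" "poly (map_poly to_ac g) x = 0"
  shows "degree f \<le> degree g"
proof -
  define P where "P = (\<lambda>h :: 'a poly. h \<noteq> 0 \<and> poly (map_poly to_ac h) x = 0)"
  obtain h where h: "P h" "\<And>h'. P h' \<Longrightarrow> degree h \<le> degree h'"
    using arg_min_nat_lemma[of P g degree] assms by (auto simp: P_def)
  have "f mod h = 0"
  proof (rule ccontr)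
    assume nz: "f mod h \<noteq> 0"
    have "map_poly to_ac f = map_poly to_ac (f div h) * map_poly to_ac h + map_poly to_ac (f mod h)"
      by (simp flip: map_to_ac_mult map_to_ac_add)
    hence "P (f mod h)" using nz h(1) assms(2) by (simp add: P_def)
    with h show False using degree_mod_less'[of h f] nz by (force simp: P_def)
  qed
  then obtain k where k: "f = h * k" by (metis dvd_def mod_eq_0_iff_dvd)
  have "\<not> is_unit h"
    using h(1) by (auto simp: P_def is_unit_poly_iff map_poly_pCons)
  with k assms(1) have "is_unit k" by (metis irreducibleD)
  with k assms(1) have "degree f = degree h"
    by (auto simp: is_unit_poly_iff)
  with h(2)[of g] assms show ?thesis by (simp add: P_def)
qed

text \<open>If d > 0 is a period of x, the product over d conjugates has coefficients in F_q and
  vanishes at x, so degree f \<le> d. Division with remainder then shows that degree f divides every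
  period.\<close>

lemma frob_degree_if_irreducible:
  fixes f :: "'a poly"
  assumes "irreducible f" "poly (map_poly to_ac f) x = 0" "x ^ (q ^ degree f) = x"
  shows "frob_degree q (degree f) x"
proof -
  have nz: "f \<noteq> 0" using assms by auto
  have "degree f > 0"
  proof (rule ccontr)
    assume "\<not> degree f > 0"
    then obtain c where "f = [:c:]" by (metis degree_eq_zeroE gr0I)
    with assms(2) nz show False by (simp add: map_poly_pCons)
  qed
  have le: "degree f \<le> d" if d: "d > 0" "x ^ (q ^ d) = x" for d
  proof -
    obtain g :: "'a poly" where g: "map_poly to_ac g = (\<Prod>i<d. [:- (x ^ (q ^ i)), 1:])"
      using conjugates_poly[OF d(2)] .
    have "degree g = degree (map_poly to_ac g)" by simp
    also have "\<dots> = d" unfolding g by (subst degree_prod_eq_sum_degree) auto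
    finally have "degree g = d" .
    moreover have "poly (map_poly to_ac g) x = 0"
      unfolding g poly_prod using d(1) by (auto intro!: prod_zero bexI[of _ 0])
    moreover have "g \<noteq> 0" using \<open>degree g = d\<close> d(1) by auto
    ultimately show ?thesis using degree_le_if_irreducible[OF assms(1,2)] by metis
  qed
  have mult: "x ^ (q ^ (degree f * j)) = x" for j
    using power_power_fixed[OF assms(3), of j] by (simp add: power_mult)
  have "degree f dvd i" if i: "x ^ (q ^ i) = x" for i
  proof (rule ccontr)
    assume ndvd: "\<not> degree f dvd i"
    have "q ^ i = q ^ (degree f * (i div degree f)) * q ^ (i mod degree f)"
      by (simp flip: power_add)
    hence "x ^ (q ^ i) = x ^ (q ^ (i mod degree f))" by (simp only: power_mult[of x] mult)
    hence "degree f \<le> i mod degree f" using ndvd i by (intro le) (auto simp: dvd_eq_mod_eq_0)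
    with mod_less_divisor[OF \<open>degree f > 0\<close>, of i] show False by simp
  qed
  with mult \<open>degree f > 0\<close> show ?thesis by (auto simp: frob_degree_def)
qed

lemma frob_degree_le_degree:
  fixes f :: "'a poly"
  assumes "f \<noteq> 0" "poly (map_poly to_ac f) x = 0" "frob_degree q N x"
  shows "N \<le> degree f"
proof -
  let ?R = "{z. poly (map_poly to_ac f) z = 0}"
  have "(\<lambda>i. x ^ (q ^ i)) ` {..<N} \<subseteq> ?R"
    using assms(2) by (auto simp: poly_frob power_0_left)
  hence "card ((\<lambda>i. x ^ (q ^ i)) ` {..<N}) \<le> card ?R"
    using assms(1) by (intro card_mono poly_roots_finite) auto
  also have "\<dots> \<le> degree f"
    using card_poly_roots_bound[of "map_poly to_ac f"] assms(1) by simp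
  finally show ?thesis using frob_degree_inj[OF assms(3) prime_char q_char] by (simp add: card_image)
qed

text \<open>In a factorization one factor vanishes at x and at all its conjugates, so it has the
  full degree and the other is constant.\<close>

lemma irreducible_if_frob_degree:
  fixes f :: "'a poly"
  assumes "f \<noteq> 0" "poly (map_poly to_ac f) x = 0" "frob_degree q (degree f) x"
  shows "irreducible f"
proof (rule irreducibleI)
  have N: "degree f > 0" using assms(3) by (simp add: frob_degree_def)
  show "f \<noteq> 0" by fact
  show "\<not> is_unit f" using N by (auto simp: is_unit_poly_iff)
  fix g h assume f: "f = g * h"
  have nz: "g \<noteq> 0" "h \<noteq> 0" using f assms(1) by auto
  have "degree f = degree g + degree h" using nz f by (simp add: degree_mult_eq)
  moreover have "poly (map_poly to_ac g) x = 0 \<or> poly (map_poly to_ac h) x = 0"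
    using assms(2) by (simp add: f map_to_ac_mult)
  ultimately have "degree g = 0 \<or> degree h = 0"
    using frob_degree_le_degree[OF nz(1) _ assms(3)] frob_degree_le_degree[OF nz(2) _ assms(3)] by auto
  thus "is_unit g \<or> is_unit h" using nz by (auto simp: is_unit_iff_degree)
qed

text \<open>Both sides are monic of the same degree and vanish at the distinct conjugates of
  x.\<close>

lemma conjugates_factorization:
  fixes f :: "'a poly"
  assumes "lead_coeff f = 1" "poly (map_poly to_ac f) x = 0" "frob_degree q (degree f) x"
  shows "map_poly to_ac f = (\<Prod>i<degree f. [:- (x ^ (q ^ i)), 1:])" (is "?f = ?g")
proof (rule poly_eqI_degree_lead_coeff[of _ "degree f"])
  have deg: "degree ?g = degree f" by (subst degree_prod_eq_sum_degree) auto
  have "lead_coeff ?g = 1" by (simp add: lead_coeff_prod)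
  thus "coeff ?f (degree f) = coeff ?g (degree f)"
    using assms(1) deg by (simp add: coeff_map_poly)
  show "degree ?f \<le> degree f" "degree ?g \<le> degree f" using deg by simp_all
  show "degree f \<le> card ((\<lambda>i. x ^ (q ^ i)) ` {..<degree f})"
    using frob_degree_inj[OF assms(3) prime_char q_char] by (simp add: card_image)
  fix z assume "z \<in> (\<lambda>i. x ^ (q ^ i)) ` {..<degree f}"
  then obtain i where i: "i < degree f" "z = x ^ (q ^ i)" by auto
  have "poly ?f z = 0" using assms(2) i by (simp add: poly_frob power_0_left)
  moreover have "poly ?g z = 0" using i by (auto simp: poly_prod)
  ultimately show "poly ?f z = poly ?g z" by simp
qed

end

subsection \<open>The recursion\<close>

text \<open>At a zero of B only the term i = N survives, because b^0 = 1.\<close>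

lemma poly_map_frac_subst:
  fixes A B f :: "'a::field poly" and z :: "'a alg_closure"
  assumes "degree f = N"
  defines "a \<equiv> poly (map_poly to_ac A) z" and "b \<equiv> poly (map_poly to_ac B) z"
  shows "poly (map_poly to_ac (frac_subst N A B f)) z =
    (if b = 0 then to_ac (lead_coeff f) * a ^ N else b ^ N * poly (map_poly to_ac f) (a / b))"
proof -
  have *: "poly (map_poly to_ac (frac_subst N A B f)) z =
      (\<Sum>i\<le>N. to_ac (coeff f i) * (a ^ i * b ^ (N - i)))"
    by (simp add: frac_subst_def assms map_to_ac_sum map_to_ac_smult map_to_ac_mult
        map_to_ac_power poly_sum)
  show ?thesis
  proof (cases "b = 0")
    case True
    have "(\<Sum>i\<le>N. to_ac (coeff f i) * (a ^ i * b ^ (N - i))) =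
        (\<Sum>i\<in>{N}. to_ac (coeff f i) * (a ^ i * b ^ (N - i)))"
      by (rule sum.mono_neutral_right) (auto simp: True)
    thus ?thesis using True by (simp add: * assms(1))
  next
    case False
    thus ?thesis
      unfolding * by (simp add: poly_altdef assms(1) coeff_map_poly sum_distrib_left)
        (intro sum.cong refl, simp add: power_diff power_divide)
  qed
qed

lemma reflect_poly_linear: "reflect_poly [:- c, 1:] = [:1, - (c :: 'a::comm_ring_1):]"
  by (rule poly_eqI) (auto simp: coeff_reflect_poly coeff_pCons split: nat.splits)

lemma monic_assoc:
  assumes "G \<noteq> 0"
  shows "degree (monic_assoc G) = degree G" "lead_coeff (monic_assoc G) = 1" "monic_assoc G \<noteq> 0"
  using assms by (simp_all add: monic_assoc_def)

section \<open>The invariant carried along the tower\<close>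

context frobenius
begin

text \<open>What the induction keeps for the roots of each reciprocal polynomial: the orbit length
  gives irreducibility, the two traces permit the next step, and the gcd degree is the k of
  k-normality.\<close>

definition good :: "nat \<Rightarrow> nat \<Rightarrow> 'a alg_closure \<Rightarrow> bool" where
  "good k N x \<longleftrightarrow> frob_degree q N x \<and> frob_sum p (m * N) x \<noteq> 0 \<and>
     frob_sum p (m * N) (1 / (x - 1)) \<noteq> 0 \<and>
     degree (gcd (monom 1 N - 1) (conj_poly q N x)) = k"

lemma good_imp_k_normal:
  assumes "good k N x" "k < N"
  shows "k_normal k N x"
  using assms frob_degreeD[of q N x N]
  by (simp add: good_def k_normal_def ext_field_def conj_poly_def card)

lemma good_step:
  assumes "good k N x" "p ^ e dvd N" "e \<ge> 1" "k < p ^ e"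
    and "d ^ p = d" "d \<noteq> 0" "y ^ p - y = d / (x - 1)"
  shows "good k (N * p) (1 / y)"
proof -
  have "p dvd N" using assms(2,3) by (intro dvd_trans[OF dvd_power, of e p N]) auto
  hence step: "artin_schreier_step p q m N x y d (d / (x - 1))"
    using assms prime_char by unfold_locales (simp_all add: char good_def)
  then interpret artin_schreier_step p q m N x y d "d / (x - 1)" .
  show ?thesis
    using degree_gcd_artin_schreier[OF step assms(2)] assms(1,4) trace_y_neq_0 frob_degree_y
    by (simp add: good_def frob_degree_inverse divide_inverse)
qed

lemma to_ac_abs_trace: "to_ac (abs_trace p m c) = frob_sum p m (to_ac (c :: 'a))"
  by (simp add: abs_trace_def frob_sum_def to_ac_sum)

text \<open>The reciprocal of f is the product of the 1 - c X over the conjugates c of x. Its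
  logarithmic derivative at 0 is minus the trace of x; at 1 it is the sum of the 1 + 1 / (c - 1),
  where the ones add up to degree f, which is 0 in characteristic p.\<close>

lemma good_initial:
  fixes f :: "'a poly"
  assumes f: "lead_coeff f = 1" "irreducible f" and root: "poly (map_poly to_ac f) x = 0"
    and normal: "k_normal k (degree f) x" and dvd: "p dvd degree f"
    and tr0: "abs_trace p m (poly (pderiv (reflect_poly f)) 0 / poly (reflect_poly f) 0) \<noteq> 0"
    and tr1: "abs_trace p m (poly (pderiv (reflect_poly f)) 1 / poly (reflect_poly f) 1) \<noteq> 0"
  shows "good k (degree f) x"
proof -
  let ?n = "degree f" and ?c = "\<lambda>i. x ^ (q ^ i)"
  have deg: "frob_degree q ?n x"
    using normal by (intro frob_degree_if_irreducible f root) (simp add: k_normal_def ext_field_def card)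
  \<comment> \<open>The element 1 has orbit length 1, which p does not divide. This keeps the
    denominators 1 - c nonzero.\<close>
  have "x \<noteq> 1"
    using deg dvd prime by (auto simp: frob_degree_def dest: spec[of _ 1])
  hence neq_1: "?c i \<noteq> 1" for i using frob_eq_iff[of x i 1] by simp
  have "map_poly to_ac (reflect_poly f) = (\<Prod>i<?n. [:1, - ?c i:])"
    unfolding map_to_ac_reflect conjugates_factorization[OF f(1) root deg] reflect_poly_prod
    by (simp only: reflect_poly_linear)
  hence logderiv: "to_ac (poly (pderiv (reflect_poly f)) z / poly (reflect_poly f) z) =
      (\<Sum>i<?n. - ?c i / (1 - to_ac z * ?c i))" if "\<And>i. 1 - to_ac z * ?c i \<noteq> 0" for z
    using that poly_pderiv_prod[of "{..<?n}" "\<lambda>i. [:1, - ?c i:]" "to_ac z"]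
    by (simp add: pderiv_pCons poly_prod map_to_ac_pderiv flip: poly_map_to_ac)
  have minus_1: "(- 1) ^ p = (- 1 :: 'a alg_closure)"
    using power_char_uminus[OF prime_char, of p 1 1] by (simp add: char)
  have tower: "frob_sum p (m * ?n) z = frob_sum p m (frob_sum q ?n z)" for z :: "'a alg_closure"
    by (rule frob_sum_mult[OF prime_char, where s = 1]) (simp add: char)
  have "to_ac (poly (pderiv (reflect_poly f)) 0 / poly (reflect_poly f) 0) = - 1 * frob_sum q ?n x"
    by (subst logderiv) (simp_all add: frob_sum_def sum_negf)
  with tr0 have "frob_sum p (m * ?n) x \<noteq> 0"
    using to_ac_abs_trace frob_sum_scale[OF minus_1, of m "frob_sum q ?n x"]
    by (metis mult_zero_right to_ac_eq_0_iff tower)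
  moreover have "to_ac (poly (pderiv (reflect_poly f)) 1 / poly (reflect_poly f) 1) =
      frob_sum q ?n (1 / (x - 1))"
  proof -
    have "to_ac (poly (pderiv (reflect_poly f)) 1 / poly (reflect_poly f) 1) =
        (\<Sum>i<?n. - ?c i / (1 - ?c i))"
      using neq_1 by (subst logderiv) auto
    also have "\<dots> = (\<Sum>i<?n. 1 + 1 / (?c i - 1))"
      using neq_1 by (intro sum.cong refl) (auto simp: divide_simps algebra_simps)
    also have "\<dots> = of_nat ?n + (\<Sum>i<?n. 1 / (?c i - 1))" by (simp add: sum.distrib)
    also have "of_nat ?n = (0 :: 'a alg_closure)"
      using dvd by (simp add: of_nat_eq_0_iff_char_dvd char)
    finally show ?thesis
      by (simp add: frob_sum_def power_divide power_char_diff[OF prime_char q_power_char])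
  qed
  with tr1 have "frob_sum p (m * ?n) (1 / (x - 1)) \<noteq> 0"
    by (metis to_ac_abs_trace to_ac_eq_0_iff tower)
  ultimately show ?thesis
    using deg normal by (simp add: good_def k_normal_def conj_poly_def card)
qed

text \<open>A root z of F_(u+1) gives the root v = (z^p - z) / (z^p - z + d) of F_u, and g = 1/v
  satisfies z^p - z = d / (g - 1). The degree is squeezed between the orbit length of a root and the
  general upper bound, which avoids computing a leading coefficient.\<close>

lemma iter_poly_good:
  fixes G :: "'a poly" and d :: 'a
  assumes "degree G = n" "coeff G 0 \<noteq> 0" "p ^ e dvd n" "e \<ge> 1" "k < p ^ e"
    and "d ^ p = d" "d \<noteq> 0" "n > 0"
    and G: "\<And>z. poly (map_poly to_ac G) z = 0 \<Longrightarrow> good k n (1 / z)"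
  defines "F \<equiv> iter_poly p n d G"
  shows "degree (F u) = n * p ^ u \<and> coeff (F u) 0 \<noteq> 0 \<and>
    (\<forall>z. poly (map_poly to_ac (F u)) z = 0 \<longrightarrow> good k (n * p ^ u) (1 / z))"
proof (induction u)
  case 0
  thus ?case using assms by simp
next
  case (Suc u)
  let ?N = "n * p ^ u" and ?d = "to_ac d" and ?w = "\<lambda>z. z ^ p - z :: 'a alg_closure"
  have deg: "degree (F u) = ?N" and F0: "coeff (F u) 0 \<noteq> 0"
    and good: "\<And>z. poly (map_poly to_ac (F u)) z = 0 \<Longrightarrow> good k ?N (1 / z)" using Suc by auto
  have nz: "F u \<noteq> 0" using F0 by auto
  have d: "?d ^ p = ?d" "?d \<noteq> 0" using assms(6,7) by (simp_all flip: to_ac_power)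
  have p1: "p \<noteq> 1" using prime by auto
  have A: "poly (map_poly to_ac (monom 1 p - monom 1 1)) z = ?w z"
    "poly (map_poly to_ac (monom 1 p - monom 1 1 + [:d:])) z = ?w z + ?d" for z
    by (simp_all add: map_to_ac_add map_to_ac_diff map_poly_monom map_poly_pCons poly_monom)
  have F_Suc: "F (Suc u) = frac_subst ?N (monom 1 p - monom 1 1) (monom 1 p - monom 1 1 + [:d:]) (F u)"
    by (simp add: F_def)
  have eval: "poly (map_poly to_ac (F (Suc u))) z =
      (if ?w z + ?d = 0 then to_ac (lead_coeff (F u)) * ?w z ^ ?N
       else (?w z + ?d) ^ ?N * poly (map_poly to_ac (F u)) (?w z / (?w z + ?d)))" for z
    unfolding F_Suc poly_map_frac_subst[OF deg] A ..
  \<comment> \<open>Where the denominator vanishes the numerator is -d, so the value there is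
    nonzero.\<close>
  have root_iff: "poly (map_poly to_ac (F (Suc u))) z = 0 \<longleftrightarrow>
      ?w z + ?d \<noteq> 0 \<and> poly (map_poly to_ac (F u)) (?w z / (?w z + ?d)) = 0" for z
    using nz d(2) unfolding eval by (cases "?w z + ?d = 0") (simp_all add: eq_neg_iff_add_eq_0[symmetric])
  have F0': "poly (map_poly to_ac (F u)) 0 \<noteq> 0"
    using F0 by (simp add: poly_0_coeff_0 coeff_map_poly)
  have good_root: "good k (?N * p) (1 / z)" if z: "poly (map_poly to_ac (F (Suc u))) z = 0" for z
  proof -
    have nz: "?w z + ?d \<noteq> 0" "poly (map_poly to_ac (F u)) (?w z / (?w z + ?d)) = 0"
      using z root_iff by auto
    have w: "?w z \<noteq> 0" using nz(2) F0' by (metis div_0)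
    have "1 / (?w z / (?w z + ?d)) - 1 = ?d / ?w z"
      using nz(1) w by (simp add: add_divide_distrib del: right_minus_eq)
    hence "?d / (1 / (?w z / (?w z + ?d)) - 1) = ?w z"
      using w d(2) by (simp del: right_minus_eq)
    hence "?w z = ?d / (1 / (?w z / (?w z + ?d)) - 1)" by (rule sym)
    moreover have "p ^ e dvd ?N" using assms(3) by (rule dvd_mult2)
    ultimately show ?thesis using good_step[OF good[OF nz(2)] _ assms(4,5) d] by blast
  qed
  \<comment> \<open>The substitution sends 0 to 0 / d = 0, so nonvanishing at 0 is inherited from
    F_u.\<close>
  have nz': "coeff (F (Suc u)) 0 \<noteq> 0"
  proof -
    have "poly (map_poly to_ac (F (Suc u))) 0 \<noteq> 0"
      using d F0' by (simp add: root_iff power_0_left)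
    thus ?thesis by (simp add: poly_0_coeff_0 coeff_map_poly)
  qed
  have "degree (F (Suc u)) = ?N * p"
  proof (rule antisym)
    show "degree (F (Suc u)) \<le> ?N * p"
      using degree_iter_poly_le[of G n p d "Suc u"] assms(1) p_gt_0
      by (simp add: F_def mult_ac del: iter_poly.simps)
    have "degree (map_poly to_ac (F u)) > 0" using assms(8) by (simp add: deg)
    then obtain v where root_v: "poly (map_poly to_ac (F u)) v = 0"
      using alg_closed_imp_poly_has_root by blast
    \<comment> \<open>For v = 1 the second trace in \<open>good\<close> would be that of 1 / 0 =
      0.\<close>
    have v01: "v \<noteq> 0" "v \<noteq> 1" using root_v F0' good[OF root_v] by (auto simp: good_def frob_sum_def power_0_left)
    \<comment> \<open>This solves v = w / (w + d) for w; a solution z of z^p - z = w is then a root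
      of F_(u+1) above v.\<close>
    define w where "w = ?d * v / (1 - v)"
    let ?S = "monom 1 p - monom 1 1 - [:w:]"
    have "coeff ?S p = 1" using p1 by (cases p) auto
    hence "coeff ?S p \<noteq> 0" by (simp only: one_neq_zero not_False_eq_True)
    hence "p \<le> degree ?S" by (rule le_degree)
    hence "degree ?S > 0" using p_gt_0 by linarith
    then obtain z where "poly ?S z = 0" using alg_closed_imp_poly_has_root by blast
    hence z: "?w z = w" by (simp add: poly_monom)
    have v: "1 - v \<noteq> 0" using v01 by simp
    hence "w + ?d = (?d * v + ?d * (1 - v)) / (1 - v)"
      by (simp add: w_def add_divide_distrib del: right_minus_eq)
    also have "?d * v + ?d * (1 - v) = ?d" by (simp add: right_diff_distrib)
    finally have w: "w + ?d = ?d / (1 - v)" .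
    have "w / (w + ?d) = v" unfolding w using v d(2) by (simp add: w_def del: right_minus_eq)
    moreover have "w + ?d \<noteq> 0" unfolding w using v d(2) by (simp del: right_minus_eq)
    ultimately have "?w z + ?d \<noteq> 0 \<and> ?w z / (?w z + ?d) = v" unfolding z by blast
    hence root: "poly (map_poly to_ac (F (Suc u))) z = 0" using root_v by (simp add: root_iff)
    hence "frob_degree q (?N * p) z"
      using good_root[OF root] by (simp add: good_def frob_degree_inverse divide_inverse)
    thus "?N * p \<le> degree (F (Suc u))" using root nz' by (intro frob_degree_le_degree) auto
  qed
  thus ?case using nz' good_root by (simp add: mult_ac)
qed

end

theorem theorem3p2:
  fixes p m n r e k :: nat and P :: "'a::finite_field poly" and \<delta> :: 'a and F :: "nat \<Rightarrow> 'a poly"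
  assumes "prime p" and "m \<ge> 1" and "CARD('a) = p ^ m"
    and "e \<ge> 1" and "n = r * p ^ e"
    and "r = 1 \<or> (prime r \<and> r \<noteq> p \<and> residue_primroot r (CARD('a)))"
    and "k \<le> n - 1"
    and "k_normal_poly k n P"
    and "\<delta> \<in> of_nat ` {1..<p}"
  defines "F \<equiv> iter_poly p n \<delta> (reflect_poly P)"
  assumes "k < p ^ e"
    and "abs_trace p m (poly (pderiv (reflect_poly P)) 0 / poly (reflect_poly P) 0) *
         abs_trace p m (poly (pderiv (reflect_poly P)) 1 / poly (reflect_poly P) 1) \<noteq> 0"
  shows "\<forall>u. degree (reflect_poly (F u)) = n * p ^ u \<and>
    k_normal_poly k (n * p ^ u) (monic_assoc (reflect_poly (F u)))"
proof
  fix u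
  interpret frobenius p m "TYPE('a)" using assms by unfold_locales
  have P: "lead_coeff P = 1" "irreducible P" "degree P = n"
    "\<And>x. poly (map_poly to_ac P) x = 0 \<Longrightarrow> k_normal k n x"
    using assms(8) by (auto simp: k_normal_poly_def)
  have "n > 0" using assms(5,6) by (auto simp: prime_gt_0_nat)
  have "p dvd n" using assms(4,5) by (simp add: dvd_power)
  have good_P: "good k n x" if "poly (map_poly to_ac P) x = 0" for x
    using good_initial[OF P(1,2) that] P(3,4) that \<open>p dvd n\<close> assms(12) by simp
  \<comment> \<open>Frobenius fixes 0, so as a root of P it would have orbit length n = 1, against p
    dividing n.\<close>
  have P0: "coeff P 0 \<noteq> 0"
  proof
    assume "coeff P 0 = 0"
    hence "poly (map_poly to_ac P) 0 = 0" by (simp add: poly_0_coeff_0 coeff_map_poly)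
    from good_P[OF this] have "frob_degree q n (0 :: 'a alg_closure)" by (simp add: good_def)
    from frob_degreeD[OF this, of 1] have "n dvd 1" by (simp add: power_0_left)
    with \<open>p dvd n\<close> prime show False by simp
  qed
  have root_reflect: "poly (map_poly to_ac (reflect_poly f)) z = 0 \<longleftrightarrow>
      z \<noteq> 0 \<and> poly (map_poly to_ac f) (1 / z) = 0" if "f \<noteq> 0" for f :: "'a poly" and z
    using that by (cases "z = 0") (simp_all add: map_to_ac_reflect poly_reflect_poly_nz divide_inverse coeff_map_poly)
  obtain j where j: "\<delta> = of_nat j" "1 \<le> j" "j < p" using assms(9) by auto
  have \<delta>: "\<delta> ^ p = \<delta>"
    using power_char_of_nat[OF prime_CHAR_finite_field[where 'a = 'a]] by (simp add: j char)
  have \<delta>0: "\<delta> \<noteq> 0"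
    using j nat_dvd_not_less[of j p] by (simp add: of_nat_eq_0_iff_char_dvd char)
  \<comment> \<open>The roots of F_0, the reciprocal of P, are the inverses of the roots of
    P.\<close>
  have "good k n (1 / z)" if "poly (map_poly to_ac (reflect_poly P)) z = 0" for z
    using that P root_reflect[of P] good_P by (metis degree_0 \<open>n > 0\<close> less_irrefl)
  hence F: "degree (F u) = n * p ^ u" "coeff (F u) 0 \<noteq> 0"
    "\<And>z. poly (map_poly to_ac (F u)) z = 0 \<Longrightarrow> good k (n * p ^ u) (1 / z)"
    using iter_poly_good[OF _ _ _ assms(4,11) \<delta> \<delta>0 \<open>n > 0\<close>, of "reflect_poly P" u] P P0 assms(5)
    by (simp_all add: F_def)
  let ?N = "n * p ^ u" and ?Q = "reflect_poly (F u)"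
  let ?M = "monic_assoc ?Q"
  have nz: "F u \<noteq> 0" "?Q \<noteq> 0" using F(2) by auto
  have deg: "degree ?Q = ?N" using F by simp
  have root: "poly (map_poly to_ac ?M) z = 0 \<longleftrightarrow> poly (map_poly to_ac ?Q) z = 0" for z
    using nz by (simp add: monic_assoc_def map_to_ac_smult)
  have good_Q: "good k ?N z" if "poly (map_poly to_ac ?M) z = 0" for z
    using F(3)[of "1 / z"] that root root_reflect[OF nz(1)] by simp
  have M: "degree ?M = ?N" "lead_coeff ?M = 1" "?M \<noteq> 0"
    using monic_assoc[OF nz(2)] deg by simp_all
  have "degree (map_poly to_ac ?M) > 0" using M(1) \<open>n > 0\<close> by simp
  then obtain z where z: "poly (map_poly to_ac ?M) z = 0"
    using alg_closed_imp_poly_has_root by blast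
  have "irreducible ?M"
    using irreducible_if_frob_degree[OF M(3) z] good_Q[OF z] M(1) by (simp add: good_def)
  moreover have "k < ?N"
    using assms(7) \<open>n > 0\<close> by (intro less_le_trans[of k n "n * p ^ u"]) (auto simp: Suc_le_eq)
  ultimately show "degree ?Q = ?N \<and> k_normal_poly k ?N ?M"
    using deg M good_Q good_imp_k_normal by (simp add: k_normal_poly_def)
qed

end
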